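(* Let $X$ be a completely regular Hausdorff space with $|X|>2$, and let $[f_1,f_2]$ be a vertex of the line graph $L(\Gamma(C(X)))$. Then the eccentricity of $[f_1,f_2]$ equals $2$ if $Z(f_1)\cup Z(f_2)=X$, and equals $3$ otherwise.
   Context: $C(X)$ is the ring of all continuous functions $X\to\mathbb{R}$ with pointwise operations. For $f\in C(X)$, $Z(f)=\{x\in X: f(x)=0\}$. $\Gamma(C(X))$ is the simple graph whose vertex set is the set of non-units of $C(X)$ (equivalently, the $f$ with $Z(f)\neq\emptyset$), two distinct vertices $f,g$ being adjacent iff $Z(f)\cap Z(g)\neq\emptyset$. Its line graph $L(\Gamma(C(X)))$ has as vertices the unordered pairs $[f,g]=[g,f]$ of distinct vertices $f,g$ of $\Gamma(C(X))$ with $Z(f)\cap Z(g)\neq\emptyset$; two distinct vertices $[f_1,f_2]$, $[g_1,g_2]$ are adjacent iff $f_i=g_j$ for some $i,j\in\{1,2\}$. The eccentricity of a vertex $u$ is $\max\{d(u,v)\}$ over all vertices $v$, with $d$ the shortest-path distance. *)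

theory Defs
  imports
    "HOL-Analysis.Analysis"
    "HOL-Algebra.Ring"
    "Graph_Theory.Graph_Theory"
begin

section \<open>The ring of continuous real-valued functions on a space\<close>

text \<open>Functions on the space \<open>X\<close> are represented by functions that are \<open>undefined\<close> outside
  \<^term>\<open>topspace X\<close>, so that equality of elements is equality on \<^term>\<open>topspace X\<close>.\<close>

definition cont_ring :: "'a topology \<Rightarrow> ('a \<Rightarrow> real) ring" where
  "cont_ring X =
    \<lparr>carrier = {f \<in> extensional (topspace X). continuous_map X euclideanreal f},
     mult = (\<lambda>f g. \<lambda>x\<in>topspace X. f x * g x),
     one = (\<lambda>x\<in>topspace X. 1),
     zero = (\<lambda>x\<in>topspace X. 0),
     add = (\<lambda>f g. \<lambda>x\<in>topspace X. f x + g x)\<rparr>"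

definition zero_set :: "'a topology \<Rightarrow> ('a \<Rightarrow> real) \<Rightarrow> 'a set" where
  "zero_set X f = {x \<in> topspace X. f x = 0}"

lemma cont_ring_cring: "cring (cont_ring X)"
proof (rule cringI)
  show "abelian_group (cont_ring X)"
  proof (rule abelian_groupI)
    fix f assume f: "f \<in> carrier (cont_ring X)"
    let ?g = "\<lambda>x\<in>topspace X. - f x"
    have "continuous_map X euclideanreal ?g"
    proof (rule continuous_map_eq)
      show "continuous_map X euclideanreal (\<lambda>x. - f x)"
        using f by (simp add: cont_ring_def)
    qed simp
    then show "\<exists>g\<in>carrier (cont_ring X). g \<oplus>\<^bsub>cont_ring X\<^esub> f = \<zero>\<^bsub>cont_ring X\<^esub>"
      by (intro bexI[of _ ?g]) (auto simp: cont_ring_def restrict_def extensional_def)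
  next
    fix f g assume "f \<in> carrier (cont_ring X)" "g \<in> carrier (cont_ring X)"
    then show "f \<oplus>\<^bsub>cont_ring X\<^esub> g \<in> carrier (cont_ring X)"
      by (auto simp: cont_ring_def intro!: continuous_map_eq[OF continuous_map_add[of X f g]])
  next
    show "\<zero>\<^bsub>cont_ring X\<^esub> \<in> carrier (cont_ring X)"
      by (auto simp: cont_ring_def intro!: continuous_map_eq[of X _ "\<lambda>_. 0"])
  qed (auto simp: cont_ring_def extensional_def fun_eq_iff)
  show "comm_monoid (cont_ring X)"
  proof (rule comm_monoidI)
    fix f g assume "f \<in> carrier (cont_ring X)" "g \<in> carrier (cont_ring X)"
    then show "f \<otimes>\<^bsub>cont_ring X\<^esub> g \<in> carrier (cont_ring X)"
      by (auto simp: cont_ring_def intro!: continuous_map_eq[OF continuous_map_real_mult[of X f g]])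
  next
    show "\<one>\<^bsub>cont_ring X\<^esub> \<in> carrier (cont_ring X)"
      by (auto simp: cont_ring_def intro!: continuous_map_eq[of X _ "\<lambda>_. 1"])
  qed (auto simp: cont_ring_def extensional_def fun_eq_iff)
qed (auto simp: cont_ring_def fun_eq_iff algebra_simps)

lemma cont_ring_Units_iff:
  assumes f: "f \<in> carrier (cont_ring X)"
  shows "f \<in> Units (cont_ring X) \<longleftrightarrow> zero_set X f = {}"
proof
  assume "f \<in> Units (cont_ring X)"
  then obtain g where "(\<lambda>x\<in>topspace X. g x * f x) = (\<lambda>x\<in>topspace X. 1)"
    by (auto simp: Units_def cont_ring_def)
  then have "g x * f x = 1" if "x \<in> topspace X" for x
    using that by (auto dest!: fun_cong[of _ _ x])
  then show "zero_set X f = {}"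
    by (force simp: zero_set_def)
next
  assume Z: "zero_set X f = {}"
  let ?g = "\<lambda>x\<in>topspace X. inverse (f x)"
  have nz: "f x \<noteq> 0" if "x \<in> topspace X" for x
    using Z that by (auto simp: zero_set_def)
  have "continuous_map X euclideanreal (\<lambda>x. inverse (f x))"
    using f nz by (intro continuous_map_real_inverse) (auto simp: cont_ring_def)
  then have "continuous_map X euclideanreal ?g"
    by (rule continuous_map_eq) simp
  then have g: "?g \<in> carrier (cont_ring X)"
    by (simp add: cont_ring_def)
  have "?g \<otimes>\<^bsub>cont_ring X\<^esub> f = \<one>\<^bsub>cont_ring X\<^esub>" "f \<otimes>\<^bsub>cont_ring X\<^esub> ?g = \<one>\<^bsub>cont_ring X\<^esub>"
    using nz by (simp_all add: cont_ring_def restrict_def fun_eq_iff)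
  with f g show "f \<in> Units (cont_ring X)"
    unfolding Units_def by blast
qed


section \<open>Simple graphs\<close>

text \<open>A simple graph is a loop-free \<^typ>\<open>'v pair_pre_digraph\<close> with a symmetric arc relation:
  an edge between \<open>u\<close> and \<open>v\<close> is the pair of arcs \<open>(u, v)\<close>, \<open>(v, u)\<close>.  The unordered pair
  with entries \<open>u\<close>, \<open>v\<close> is the two-element set \<open>{u, v}\<close>.\<close>

definition line_graph :: "'v pair_pre_digraph \<Rightarrow> 'v set pair_pre_digraph" where
  "line_graph G =
    \<lparr>pverts = {{u, v} | u v. (u, v) \<in> parcs G},
     parcs = {({u1, u2}, {v1, v2}) | u1 u2 v1 v2.
        (u1, u2) \<in> parcs G \<and> (v1, v2) \<in> parcs G \<and> {u1, u2} \<noteq> {v1, v2} \<and>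
        (u1 = v1 \<or> u1 = v2 \<or> u2 = v1 \<or> u2 = v2)}\<rparr>"

text \<open>Shortest-path distance: every arc has cost 1; it is \<open>\<infinity>\<close> if there is no walk.\<close>

definition graph_dist :: "'v pair_pre_digraph \<Rightarrow> 'v \<Rightarrow> 'v \<Rightarrow> ereal" where
  "graph_dist G u v = wf_digraph.\<mu> (with_proj G) (\<lambda>_. 1) u v"

text \<open>Distances are natural numbers or \<open>\<infinity>\<close>, so a finite supremum over a nonempty vertex set
  is attained, i.e. it is a maximum.\<close>

definition eccentricity :: "'v pair_pre_digraph \<Rightarrow> 'v \<Rightarrow> ereal" where
  "eccentricity G u = (SUP v\<in>pverts G. graph_dist G u v)"

lemma wf_line_graph: "wf_digraph (with_proj (line_graph G))"
  by unfold_locales (auto simp: line_graph_def)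


section \<open>The zero-set intersection graph of the ring of continuous functions\<close>

definition zero_set_graph :: "'a topology \<Rightarrow> ('a \<Rightarrow> real) pair_pre_digraph" where
  "zero_set_graph X =
    (let V = carrier (cont_ring X) - Units (cont_ring X) in
    \<lparr>pverts = V,
     parcs = {(f, g). f \<in> V \<and> g \<in> V \<and> f \<noteq> g \<and> zero_set X f \<inter> zero_set X g \<noteq> {}}\<rparr>)"

lemma zero_set_graph_simple:
  "wf_digraph (with_proj (zero_set_graph X))" "sym (parcs (zero_set_graph X))"
  "irrefl (parcs (zero_set_graph X))"
proof -
  show "wf_digraph (with_proj (zero_set_graph X))"
    by unfold_locales (auto simp: zero_set_graph_def Let_def)
qed (auto simp: zero_set_graph_def Let_def sym_def irrefl_def)

lemma line_graph_simple:
  "sym (parcs (line_graph G))" "irrefl (parcs (line_graph G))"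
proof -
  show "sym (parcs (line_graph G))"
  proof (rule symI)
    fix a b assume "(a, b) \<in> parcs (line_graph G)"
    then obtain u1 u2 v1 v2 where "a = {u1, u2}" "b = {v1, v2}"
      and "(v1, v2) \<in> parcs G \<and> (u1, u2) \<in> parcs G \<and> {v1, v2} \<noteq> {u1, u2} \<and>
        (v1 = u1 \<or> v1 = u2 \<or> v2 = u1 \<or> v2 = u2)"
      unfolding line_graph_def by (simp only: pair_pre_digraph.simps) blast
    then show "(b, a) \<in> parcs (line_graph G)"
      unfolding line_graph_def by (simp only: pair_pre_digraph.simps) blast
  qed
  show "irrefl (parcs (line_graph G))"
    unfolding line_graph_def irrefl_def by (simp only: pair_pre_digraph.simps) blast
qed

end

theory Submission
  imports Defs
begin

text \<open>The distance from \<open>[f\<^sub>1, f\<^sub>2]\<close> to a disjoint edge \<open>[g\<^sub>1, g\<^sub>2]\<close> is 2 if some \<open>Z(f\<^sub>i)\<close> meets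
  some \<open>Z(g\<^sub>j)\<close>, and otherwise 3, because the constant 0 is adjacent to everything.  If
  \<open>Z(f\<^sub>1) \<union> Z(f\<^sub>2) = X\<close>, only distances up to 2 occur, and disjoint edges are found among the
  scalar multiples of a nonzero \<open>f\<^sub>i\<close>.  If \<open>p\<close> lies outside \<open>Z(f\<^sub>1) \<union> Z(f\<^sub>2)\<close>, then
  \<open>h = f\<^sub>1 f\<^sub>2 - f\<^sub>1(p) f\<^sub>2(p)\<close> vanishes at \<open>p\<close> but nowhere on \<open>Z(f\<^sub>1) \<union> Z(f\<^sub>2)\<close>, and \<open>[h, 2h]\<close> is at
  distance 3.\<close>

section \<open>Shortest-path distance and powers of the arc relation\<close>

text \<open>Unrolling the relation power gives a walk with \<open>n\<close> arcs, whose cost is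
  \<open>n\<close>. That \<open>u\<close> is a vertex serves the empty walk at
  \<open>n = 0\<close>.\<close>

lemma graph_dist_le_relpow:
  assumes wf: "wf_digraph (with_proj G)" and u: "u \<in> pverts G"
    and uv: "(u, v) \<in> parcs G ^^ n"
  shows "graph_dist G u v \<le> ereal (real n)"
proof -
  interpret wf_digraph "with_proj G" by (rule wf)
  have "\<exists>p. awalk u p v \<and> length p = n"
    using uv
  proof (induction n arbitrary: v)
    case 0
    with u show ?case by (auto simp: awalk_Nil_iff)
  next
    case (Suc n)
    then obtain w where w: "(u, w) \<in> parcs G ^^ n" and wv: "(w, v) \<in> parcs G"
      by auto
    from Suc.IH[OF w] obtain p where "awalk u p w" "length p = n"
      by blast
    moreover have "awalk w [(w, v)] v"
      using arc_implies_awalk[of "(w, v)"] wv by simp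
    ultimately show ?case
      by (intro exI[of _ "p @ [(w, v)]"]) auto
  qed
  then obtain p where "awalk u p v" "length p = n" by blast
  then show ?thesis
    using min_cost_le_walk_cost[of u p v "\<lambda>_. 1"]
    by (simp add: graph_dist_def awalk_cost_def sum_list_triv)
qed

text \<open>A walk of length \<open>k\<close> puts its ends into the \<open>k\<close>-th power, so
  no walk is shorter than \<open>n\<close>. If there is no walk at all, the infimum is \<infinity>
  and the bound still holds.\<close>

lemma le_graph_dist_relpow:
  assumes wf: "wf_digraph (with_proj G)"
    and uv: "\<And>k. k < n \<Longrightarrow> (u, v) \<notin> parcs G ^^ k"
  shows "ereal (real n) \<le> graph_dist G u v"
proof -
  interpret wf_digraph "with_proj G" by (rule wf)
  have relpow: "(u, v) \<in> parcs G ^^ length p" if "awalk u p v" for p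
    using that
  proof (induction p arbitrary: u)
    case (Cons e p)
    then have "(u, snd e) \<in> parcs G" "awalk (snd e) p v"
      by (auto simp: awalk_Cons_iff)
    with Cons.IH have "(u, v) \<in> parcs G ^^ Suc (length p)"
      by (blast intro: relpow_Suc_I2)
    then show ?case by simp
  qed (simp add: awalk_Nil_iff)
  have "n \<le> length p" if "awalk u p v" for p
    using relpow[OF that] uv[of "length p"] by (meson not_le)
  then show ?thesis
    by (auto simp: graph_dist_def \<mu>_def awalk_cost_def sum_list_triv intro!: INF_greatest)
qed

section \<open>Vertices and arcs as set conditions\<close>

lemma mem_line_graph_verts:
  "a \<in> pverts (line_graph G) \<longleftrightarrow> (\<exists>u v. a = {u, v} \<and> (u, v) \<in> parcs G)"
  by (auto simp: line_graph_def)

lemma mem_line_graph_arcs: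
  "(a, b) \<in> parcs (line_graph G) \<longleftrightarrow>
    a \<in> pverts (line_graph G) \<and> b \<in> pverts (line_graph G) \<and> a \<noteq> b \<and> a \<inter> b \<noteq> {}"
  (is "?l \<longleftrightarrow> ?r")
proof
  assume ?l
  then obtain u1 u2 v1 v2 where "a = {u1, u2}" "b = {v1, v2}"
    "(u1, u2) \<in> parcs G" "(v1, v2) \<in> parcs G" "{u1, u2} \<noteq> {v1, v2}"
    "u1 = v1 \<or> u1 = v2 \<or> u2 = v1 \<or> u2 = v2"
    unfolding line_graph_def by (simp only: pair_pre_digraph.simps) blast
  then show ?r
    unfolding mem_line_graph_verts by blast
next
  assume ?r
  then obtain u1 u2 v1 v2 where "a = {u1, u2}" "b = {v1, v2}"
    "(u1, u2) \<in> parcs G" "(v1, v2) \<in> parcs G" "{u1, u2} \<noteq> {v1, v2}"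
    "u1 = v1 \<or> u1 = v2 \<or> u2 = v1 \<or> u2 = v2"
    unfolding mem_line_graph_verts by blast
  then show ?l
    unfolding line_graph_def by (simp only: pair_pre_digraph.simps) blast
qed

text \<open>A common zero already makes both functions non-units, so the vertex condition is
  absorbed.\<close>

lemma zero_set_graph_arcs:
  "(f, g) \<in> parcs (zero_set_graph X) \<longleftrightarrow>
    f \<in> carrier (cont_ring X) \<and> g \<in> carrier (cont_ring X) \<and> f \<noteq> g \<and>
    zero_set X f \<inter> zero_set X g \<noteq> {}"
  using cont_ring_Units_iff[of f X] cont_ring_Units_iff[of g X]
  by (auto simp: zero_set_graph_def Let_def)

text \<open>The arc relation is symmetric, so the order in which an unordered pair is written does
  not matter.\<close>

lemma line_graph_zero_set_graph_verts:
  "{f, g} \<in> pverts (line_graph (zero_set_graph X)) \<longleftrightarrow> (f, g) \<in> parcs (zero_set_graph X)"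
  by (auto simp: mem_line_graph_verts zero_set_graph_arcs doubleton_eq_iff)

lemma restrict_mem_cont_ring:
  assumes "continuous_map X euclideanreal f"
  shows "restrict f (topspace X) \<in> carrier (cont_ring X)"
  using assms by (auto simp: cont_ring_def intro: continuous_map_eq)

section \<open>Distance bounds in terms of zero sets\<close>

lemma line_graph_dist_le_2:
  assumes f: "(f1, f2) \<in> parcs (zero_set_graph X)"
    and g: "(g1, g2) \<in> parcs (zero_set_graph X)"
    and "a \<in> {f1, f2}" "b \<in> {g1, g2}" "zero_set X a \<inter> zero_set X b \<noteq> {}"
  shows "graph_dist (line_graph (zero_set_graph X)) {f1, f2} {g1, g2} \<le> 2"
proof -
  let ?L = "line_graph (zero_set_graph X)"
  have V: "{f1, f2} \<in> pverts ?L" "{g1, g2} \<in> pverts ?L"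
    using f g by (simp_all add: line_graph_zero_set_graph_verts)
  have "\<exists>k\<le>2. ({f1, f2}, {g1, g2}) \<in> parcs ?L ^^ k"
  proof (cases "{f1, f2} \<inter> {g1, g2} = {}")
    case False
    then show ?thesis
    proof (cases "{f1, f2} = {g1, g2}")
      case True
      then show ?thesis by (intro exI[of _ 0]) simp
    next
      case ne: False
      have "({f1, f2}, {g1, g2}) \<in> parcs ?L"
        unfolding mem_line_graph_arcs using V ne False by blast
      then show ?thesis by (intro exI[of _ 1]) simp
    qed
  next
    case True
    \<comment> \<open>The pairs are disjoint, so \<open>a\<close> and \<open>b\<close> differ; their
      common zero makes \<open>{a, b}\<close> an edge, which links the two pairs.\<close>
    have "{a, b} \<in> pverts ?L"
      using assms True by (auto simp: line_graph_zero_set_graph_verts zero_set_graph_arcs)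
    then have "({f1, f2}, {a, b}) \<in> parcs ?L" "({a, b}, {g1, g2}) \<in> parcs ?L"
      unfolding mem_line_graph_arcs using V assms(3,4) True by blast+
    then show ?thesis by (intro exI[of _ 2]) (auto simp: numeral_2_eq_2)
  qed
  then obtain k where "k \<le> 2" "({f1, f2}, {g1, g2}) \<in> parcs ?L ^^ k" by blast
  then have "graph_dist ?L {f1, f2} {g1, g2} \<le> ereal (real k)" "ereal (real k) \<le> 2"
    using graph_dist_le_relpow[OF wf_line_graph V(1)] by auto
  then show ?thesis by (rule order_trans)
qed

lemma line_graph_dist_le_3:
  assumes f: "(f1, f2) \<in> parcs (zero_set_graph X)"
    and g: "(g1, g2) \<in> parcs (zero_set_graph X)"
  shows "graph_dist (line_graph (zero_set_graph X)) {f1, f2} {g1, g2} \<le> 3"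
proof (cases "\<exists>a\<in>{f1, f2}. \<exists>b\<in>{g1, g2}. zero_set X a \<inter> zero_set X b \<noteq> {}")
  case True
  then obtain a b where "a \<in> {f1, f2}" "b \<in> {g1, g2}" "zero_set X a \<inter> zero_set X b \<noteq> {}"
    by blast
  then have "graph_dist (line_graph (zero_set_graph X)) {f1, f2} {g1, g2} \<le> 2"
    by (rule line_graph_dist_le_2[OF f g])
  also have "(2::ereal) \<le> 3" by simp
  finally show ?thesis .
next
  case False
  let ?L = "line_graph (zero_set_graph X)"
  let ?z = "\<lambda>x\<in>topspace X. 0 :: real"
  have Zz: "zero_set X ?z = topspace X"
    by (auto simp: zero_set_def)
  have sub: "zero_set X h \<subseteq> topspace X" for h
    by (auto simp: zero_set_def)
  have nonempty: "zero_set X f1 \<noteq> {}" "zero_set X g1 \<noteq> {}"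
    using f g by (auto simp: zero_set_graph_arcs)
  have z: "?z \<in> carrier (cont_ring X)"
    by (rule restrict_mem_cont_ring) simp
  \<comment> \<open>The zero set of \<open>?z\<close> is the whole space, so as an entry of one pair
    it would meet a nonempty zero set of the other.\<close>
  have ne: "?z \<notin> {f1, f2}" "?z \<notin> {g1, g2}"
    using False Zz sub nonempty by blast+
  have disj: "{f1, f2} \<inter> {g1, g2} = {}"
    using False f g by (auto simp: zero_set_graph_arcs)
  have "(f1, ?z) \<in> parcs (zero_set_graph X)" "(?z, g1) \<in> parcs (zero_set_graph X)"
    unfolding zero_set_graph_arcs Zz
    using f g z ne nonempty sub[of f1] sub[of g1] by (auto simp: zero_set_graph_arcs)
  then have V: "{f1, f2} \<in> pverts ?L" "{g1, g2} \<in> pverts ?L"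
      "{f1, ?z} \<in> pverts ?L" "{?z, g1} \<in> pverts ?L"
    using f g by (simp_all only: line_graph_zero_set_graph_verts)
  \<comment> \<open>Consecutive pairs share \<open>f1\<close>, then \<open>?z\<close>, then
    \<open>g1\<close>.\<close>
  have "({f1, f2}, {f1, ?z}) \<in> parcs ?L" "({f1, ?z}, {?z, g1}) \<in> parcs ?L"
      "({?z, g1}, {g1, g2}) \<in> parcs ?L"
    unfolding mem_line_graph_arcs using V ne disj by blast+
  then have "({f1, f2}, {g1, g2}) \<in> parcs ?L ^^ 3"
    by (auto simp: numeral_3_eq_3)
  from graph_dist_le_relpow[OF wf_line_graph V(1) this] show ?thesis
    by simp
qed

lemma line_graph_dist_ge_2:
  assumes "{f1, f2} \<inter> {g1, g2} = {}"
  shows "2 \<le> graph_dist (line_graph G) {f1, f2} {g1, g2}"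
proof -
  have "({f1, f2}, {g1, g2}) \<notin> parcs (line_graph G) ^^ k" if "k < 2" for k
  proof -
    from that consider "k = 0" | "k = 1" by linarith
    then show ?thesis
      using assms by cases (auto simp: mem_line_graph_arcs)
  qed
  from le_graph_dist_relpow[OF wf_line_graph this, where n = 2] show ?thesis
    by simp
qed

text \<open>The midpoint of a path of length 2 would be an edge with one entry in each pair, hence a
  forbidden common zero.\<close>

lemma line_graph_dist_ge_3:
  assumes f: "(f1, f2) \<in> parcs (zero_set_graph X)"
    and disj: "\<And>a b. a \<in> {f1, f2} \<Longrightarrow> b \<in> {g1, g2} \<Longrightarrow> zero_set X a \<inter> zero_set X b = {}"
  shows "3 \<le> graph_dist (line_graph (zero_set_graph X)) {f1, f2} {g1, g2}"
proof -
  let ?L = "line_graph (zero_set_graph X)"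
  \<comment> \<open>A shared entry would have an empty zero set, but \<open>f1\<close> and
    \<open>f2\<close> have zeros.\<close>
  have fg: "{f1, f2} \<inter> {g1, g2} = {}"
    using f disj by (auto simp: zero_set_graph_arcs)
  have "({f1, f2}, {g1, g2}) \<notin> parcs ?L ^^ k" if "k < 3" for k
  proof
    assume k: "({f1, f2}, {g1, g2}) \<in> parcs ?L ^^ k"
    from that consider "k = 0" | "k = 1" | "k = 2" by linarith
    then show False
    proof cases
      case 3
      with k obtain c where "({f1, f2}, c) \<in> parcs ?L" "(c, {g1, g2}) \<in> parcs ?L"
        by (auto simp: numeral_2_eq_2)
      then have c: "c \<in> pverts ?L" "{f1, f2} \<inter> c \<noteq> {}" "c \<inter> {g1, g2} \<noteq> {}"
        unfolding mem_line_graph_arcs by blast+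
      then obtain x y where "c = {x, y}" "zero_set X x \<inter> zero_set X y \<noteq> {}"
        by (auto simp: mem_line_graph_verts zero_set_graph_arcs)
      then obtain a b where "a \<in> {f1, f2}" "b \<in> {g1, g2}" "zero_set X a \<inter> zero_set X b \<noteq> {}"
        using c fg by blast
      with disj show False by blast
    qed (use k fg in \<open>auto simp: mem_line_graph_arcs\<close>)
  qed
  from le_graph_dist_relpow[OF wf_line_graph this, where n = 3] show ?thesis
    by simp
qed

section \<open>Edges that attain the bounds\<close>

lemma exists_disjoint_edge:
  assumes f: "(f1, f2) \<in> parcs (zero_set_graph X)"
  obtains g1 g2 where "(g1, g2) \<in> parcs (zero_set_graph X)" "{f1, f2} \<inter> {g1, g2} = {}"
proof -
  \<comment> \<open>The entries of an edge are distinct, so at most one of them is the zero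
    function.\<close>
  obtain f where f_mem: "f \<in> {f1, f2}" and nz: "f \<noteq> (\<lambda>x\<in>topspace X. 0)"
    using f by (auto simp: zero_set_graph_arcs)
  have f_carrier: "f \<in> carrier (cont_ring X)" and "zero_set X f \<noteq> {}"
    using f f_mem by (auto simp: zero_set_graph_arcs)
  then obtain x where x: "x \<in> topspace X" "f x = 0"
    by (auto simp: zero_set_def)
  obtain y where y: "y \<in> topspace X" "f y \<noteq> 0"
  proof -
    have "\<exists>y\<in>topspace X. f y \<noteq> 0"
    proof (rule ccontr)
      assume "\<not> (\<exists>y\<in>topspace X. f y \<noteq> 0)"
      then have "f = (\<lambda>x\<in>topspace X. 0)"
        using f_carrier by (intro extensionalityI[of f "topspace X"]) (simp_all add: cont_ring_def)
      with nz show False ..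
    qed
    with that show ?thesis by blast
  qed
  define m where "m c = (\<lambda>x\<in>topspace X. c * f x)" for c
  have "continuous_map X euclideanreal f"
    using f_carrier by (simp add: cont_ring_def)
  then have m: "m c \<in> carrier (cont_ring X)" for c
    unfolding m_def by (intro restrict_mem_cont_ring continuous_map_real_mult) simp_all
  have x_zero: "x \<in> zero_set X (m c)" for c
    using x by (simp add: m_def zero_set_def)
  have inj: "inj m"
  proof (rule injI)
    fix c d assume "m c = m d"
    then have "m c y = m d y" by simp
    with y show "c = d" by (simp add: m_def)
  qed
  have "infinite (range m - {f1, f2})"
    using inj infinite_UNIV_char_0[where ?'a = real] by (simp add: finite_image_iff)
  then obtain g1 where g1: "g1 \<in> range m - {f1, f2}"
    by (metis finite.emptyI ex_in_conv)
  with \<open>infinite _\<close> obtain g2 where g2: "g2 \<in> range m - {f1, f2} - {g1}"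
    by (metis finite.emptyI ex_in_conv infinite_remove)
  show ?thesis
  proof
    show "(g1, g2) \<in> parcs (zero_set_graph X)"
      using g1 g2 m x_zero unfolding zero_set_graph_arcs by blast
    show "{f1, f2} \<inter> {g1, g2} = {}"
      using g1 g2 by blast
  qed
qed

lemma exists_edge_with_disjoint_zero_sets:
  assumes f: "(f1, f2) \<in> parcs (zero_set_graph X)"
    and ne: "zero_set X f1 \<union> zero_set X f2 \<noteq> topspace X"
  obtains g1 g2 where "(g1, g2) \<in> parcs (zero_set_graph X)"
    "\<And>a b. a \<in> {f1, f2} \<Longrightarrow> b \<in> {g1, g2} \<Longrightarrow> zero_set X a \<inter> zero_set X b = {}"
proof -
  obtain p where p: "p \<in> topspace X" "f1 p \<noteq> 0" "f2 p \<noteq> 0"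
    using ne by (auto simp: zero_set_def)
  obtain q where q: "q \<in> topspace X" "f1 q = 0"
    using f by (auto simp: zero_set_graph_arcs zero_set_def)
  define m where "m c = (\<lambda>x\<in>topspace X. c * (f1 x * f2 x - f1 p * f2 p))" for c
  have "continuous_map X euclideanreal f1" "continuous_map X euclideanreal f2"
    using f by (auto simp: zero_set_graph_arcs cont_ring_def)
  then have m: "m c \<in> carrier (cont_ring X)" for c
    unfolding m_def
    by (intro restrict_mem_cont_ring continuous_map_real_mult continuous_map_diff) auto
  have "m 1 q \<noteq> m 2 q"
    using p q by (simp add: m_def)
  then have m_ne: "m 1 \<noteq> m 2" by metis
  show ?thesis
  proof
    have "p \<in> zero_set X (m c)" for c
      using p by (simp add: m_def zero_set_def)
    then show "(m 1, m 2) \<in> parcs (zero_set_graph X)"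
      using m m_ne unfolding zero_set_graph_arcs by blast
    show "zero_set X a \<inter> zero_set X b = {}" if "a \<in> {f1, f2}" "b \<in> {m 1, m 2}" for a b
      using that p by (auto simp: zero_set_def m_def)
  qed
qed

theorem theorem5p4:
  fixes X :: "'a topology" and f1 f2 :: "'a \<Rightarrow> real"
  assumes "completely_regular_space X" and "Hausdorff_space X"
    and "infinite (topspace X) \<or> card (topspace X) > 2"
    and "{f1, f2} \<in> pverts (line_graph (zero_set_graph X))"
  shows "eccentricity (line_graph (zero_set_graph X)) {f1, f2} =
    (if zero_set X f1 \<union> zero_set X f2 = topspace X then 2 else 3)"
proof -
  let ?L = "line_graph (zero_set_graph X)"
  have f: "(f1, f2) \<in> parcs (zero_set_graph X)"
    using assms(4) by (simp add: line_graph_zero_set_graph_verts)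
  have ecc: "eccentricity ?L {f1, f2} = d"
    if le: "\<And>g1 g2. (g1, g2) \<in> parcs (zero_set_graph X) \<Longrightarrow> graph_dist ?L {f1, f2} {g1, g2} \<le> d"
      and g: "(g1, g2) \<in> parcs (zero_set_graph X)"
      and ge: "d \<le> graph_dist ?L {f1, f2} {g1, g2}" for d g1 g2
    unfolding eccentricity_def
  proof (rule antisym)
    show "(SUP v\<in>pverts ?L. graph_dist ?L {f1, f2} v) \<le> d"
      using le by (auto simp: mem_line_graph_verts intro!: SUP_least)
    show "d \<le> (SUP v\<in>pverts ?L. graph_dist ?L {f1, f2} v)"
      using ge g by (intro SUP_upper2[of "{g1, g2}"]) (auto simp: mem_line_graph_verts)
  qed
  show ?thesis
  proof (cases "zero_set X f1 \<union> zero_set X f2 = topspace X")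
    case True
    obtain g1 g2 where g: "(g1, g2) \<in> parcs (zero_set_graph X)" "{f1, f2} \<inter> {g1, g2} = {}"
      using exists_disjoint_edge[OF f] .
    have "eccentricity ?L {f1, f2} = 2"
    proof (rule ecc[OF _ g(1) line_graph_dist_ge_2[OF g(2)]])
      fix h1 h2 assume h: "(h1, h2) \<in> parcs (zero_set_graph X)"
      then obtain x where "x \<in> zero_set X h1"
        by (auto simp: zero_set_graph_arcs)
      moreover from this have "x \<in> zero_set X f1 \<union> zero_set X f2"
        unfolding True by (simp add: zero_set_def)
      ultimately obtain a where "a \<in> {f1, f2}" "zero_set X a \<inter> zero_set X h1 \<noteq> {}"
        by blast
      then show "graph_dist ?L {f1, f2} {h1, h2} \<le> 2"
        by (intro line_graph_dist_le_2[OF f h]) auto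
    qed
    with True show ?thesis by simp
  next
    case False
    obtain g1 g2 where g: "(g1, g2) \<in> parcs (zero_set_graph X)"
      "\<And>a b. a \<in> {f1, f2} \<Longrightarrow> b \<in> {g1, g2} \<Longrightarrow> zero_set X a \<inter> zero_set X b = {}"
      using exists_edge_with_disjoint_zero_sets[OF f False] by metis
    have "eccentricity ?L {f1, f2} = 3"
      using ecc[OF line_graph_dist_le_3[OF f] g(1) line_graph_dist_ge_3[OF f g(2)]] .
    with False show ?thesis by simp
  qed
qed

end
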